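(* If $T$ is a tree of order at least three, then $\mathcal{D}_{\mathrm{lir}}(T) \leq 1$.
   Context: A (multi)graph is locally irregular if the two endvertices of every edge have different degrees (degrees in multigraphs count parallel edges with multiplicity). For a graph $G$ and a set $E_d \subseteq E(G)$, $G + E_d$ denotes the multigraph obtained from $G$ by replacing each edge of $E_d$ by two parallel edges. For a connected graph $G$ not isomorphic to $K_2$ or $K_3$, $\mathcal{D}_{\mathrm{lir}}(G)$ is the minimum size of a set $E_d \subseteq E(G)$ such that the edges of $G+E_d$ can be colored with at most two colors so that each color class induces a locally irregular sub(multi)graph and any two parallel edges receive the same color. *)

theory Defs
  imports Main "HOL-Library.FuncSet" "HOL-Library.Extended_Nat"
begin

section \<open>Finite simple graphs and trees\<close>

definition simple_graph :: "'a set \<Rightarrow> 'a set set \<Rightarrow> bool" where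
  "simple_graph V E \<longleftrightarrow> finite V \<and> E \<subseteq> {{u, v} | u v. u \<in> V \<and> v \<in> V \<and> u \<noteq> v}"

definition graph_walk :: "'a set \<Rightarrow> 'a set set \<Rightarrow> 'a list \<Rightarrow> bool" where
  "graph_walk V E p \<longleftrightarrow> p \<noteq> [] \<and> set p \<subseteq> V \<and> successively (\<lambda>u v. {u, v} \<in> E) p"

definition graph_connected :: "'a set \<Rightarrow> 'a set set \<Rightarrow> bool" where
  "graph_connected V E \<longleftrightarrow>
     V \<noteq> {} \<and> (\<forall>u\<in>V. \<forall>v\<in>V. \<exists>p. graph_walk V E p \<and> hd p = u \<and> last p = v)"

definition graph_cycle :: "'a set \<Rightarrow> 'a set set \<Rightarrow> 'a list \<Rightarrow> bool" where
  "graph_cycle V E p \<longleftrightarrow>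
     graph_walk V E p \<and> distinct p \<and> 3 \<le> length p \<and> {last p, hd p} \<in> E"

definition is_tree :: "'a set \<Rightarrow> 'a set set \<Rightarrow> bool" where
  "is_tree V E \<longleftrightarrow> simple_graph V E \<and> graph_connected V E \<and> \<not> (\<exists>p. graph_cycle V E p)"

section \<open>Loopless multigraphs\<close>

text \<open>Edges are abstract identifiers, each mapped to its two-element set of endvertices.
  Distinct identifiers with the same endvertices are parallel edges.\<close>

record ('a, 'e) multigraph =
  mverts :: "'a set"
  medges :: "'e set"
  ends :: "'e \<Rightarrow> 'a set"

definition mdegree :: "('a, 'e) multigraph \<Rightarrow> 'a \<Rightarrow> nat" where
  "mdegree M v = card {e \<in> medges M. v \<in> ends M e}"

definition locally_irregular :: "('a, 'e) multigraph \<Rightarrow> bool" where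
  "locally_irregular M \<longleftrightarrow>
     (\<forall>e\<in>medges M. \<forall>u\<in>ends M e. \<forall>v\<in>ends M e. u \<noteq> v \<longrightarrow> mdegree M u \<noteq> mdegree M v)"

definition edge_induced :: "('a, 'e) multigraph \<Rightarrow> 'e set \<Rightarrow> ('a, 'e) multigraph" where
  "edge_induced M F = \<lparr>mverts = (\<Union>e\<in>F. ends M e), medges = F, ends = ends M\<rparr>"

definition double_edges :: "'a set \<Rightarrow> 'a set set \<Rightarrow> 'a set set \<Rightarrow> ('a, 'a set \<times> bool) multigraph" where
  "double_edges V E Ed =
     \<lparr>mverts = V, medges = E \<times> {False} \<union> Ed \<times> {True}, ends = fst\<rparr>"

text \<open>Colour classes may be empty, so this means at most two colours.\<close>

definition lir_2_colouring :: "('a, 'e) multigraph \<Rightarrow> ('e \<Rightarrow> nat) \<Rightarrow> bool" where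
  "lir_2_colouring M c \<longleftrightarrow>
     c \<in> medges M \<rightarrow> {..<2} \<and>
     (\<forall>i<2. locally_irregular (edge_induced M {e \<in> medges M. c e = i})) \<and>
     (\<forall>e\<in>medges M. \<forall>f\<in>medges M. ends M e = ends M f \<longrightarrow> c e = c f)"

text \<open>The infimum is a minimum whenever some admissible set exists; it is \<open>\<infinity>\<close> otherwise,
  so a finite upper bound asserts existence. The parameter is only meaningful for connected
  simple graphs other than \<open>K\<^sub>2\<close> and \<open>K\<^sub>3\<close>.\<close>

definition D_lir :: "'a set \<Rightarrow> 'a set set \<Rightarrow> enat" where
  "D_lir V E = (INF Ed \<in> {Ed. Ed \<subseteq> E \<and> (\<exists>c. lir_2_colouring (double_edges V E Ed) c)}. enat (card Ed))"

end

(*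
  Work from the leaves of a rooted tree up and decide for every non-root w which child edges repeat
  the colour of the edge from w to its parent, so that no child edge of w joins two vertices of
  equal degree in its colour. This only involves the degrees that the children already have in the
  colours of their own parent edges, and a counting argument shows that a suitable choice always
  exists. The colouring is then read off from the root downwards.

  Take as root a vertex all of whose neighbours but at most one, y, are leaves, and give all its
  k >= 2 edges the same colour. Only the edge to y can fail, namely when y also has degree k in
  that colour. Doubling the edge to some leaf then raises the degree of the root to k + 1 and that
  of the leaf to 2, and nothing else changes.
*)

theory Submission
  imports Defs
begin

section \<open>Counting: splitting a finite set so as to avoid forbidden values\<close>

lemma sum_card_fibres_le:
  assumes "finite K" "finite X"
  shows "(\<Sum>x\<in>X. card {i\<in>K. a i = x}) \<le> card K"
proof -
  have "(\<Sum>x\<in>X. card {i\<in>K. a i = x}) = card (\<Union>x\<in>X. {i\<in>K. a i = x})"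
    using assms by (subst card_UN_disjoint) auto
  also have "\<dots> \<le> card K"
    using assms by (intro card_mono) auto
  finally show ?thesis .
qed

lemma double_le_sum_Suc: "Suc (2 * h) \<le> (\<Sum>i\<le>h. Suc i)"
  by (induction h) auto

text \<open>If no \<open>S\<close> of size \<open>s\<close> works, then one of the two forbidden values \<open>s + 1\<close>, \<open>k - s\<close> is taken
  too often. Over all \<open>s \<ge> k / 2\<close> this forces more than \<open>k\<close> indices in total.\<close>

lemma balanced_split:
  fixes a :: "'b \<Rightarrow> nat"
  assumes K: "finite K"
  shows "\<exists>S\<subseteq>K. (\<forall>i\<in>S. a i \<noteq> Suc (card S)) \<and> (\<forall>i\<in>K - S. a i \<noteq> card K - card S)"
proof (rule ccontr)
  assume no: "\<not> ?thesis"
  define k where "k = card K"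
  define N where "N x = card {i\<in>K. a i = x}" for x
  have N_sum: "(\<Sum>x\<in>X. N x) \<le> k" if "finite X" for X
    unfolding N_def k_def using sum_card_fibres_le[OF K that] .
  \<comment> \<open>Indices of value \<open>Suc s\<close> must stay outside \<open>S\<close> and
    those of value \<open>k - s\<close> must lie inside. Some set of size \<open>s\<close> achieves
    both unless one class is too large, or the two values coincide and are attained.\<close>
  have bad: "k - s < N (Suc s) \<or> s < N (k - s) \<or> (Suc s = k - s \<and> 0 < N (Suc s))" if "s \<le> k" for s
  proof (rule ccontr)
    let ?B = "{i\<in>K. a i = Suc s}" and ?C = "{i\<in>K. a i = k - s}"
    assume "\<not> ?thesis"
    then have B: "card ?B \<le> k - s" and C: "card ?C \<le> s" and BC: "Suc s = k - s \<Longrightarrow> ?B = {}"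
      using K by (auto simp: N_def)
    have "s \<le> card (K - ?B)"
      using B that K by (subst card_Diff_subset) (auto simp: k_def)
    moreover have "?C \<subseteq> K - ?B"
      using BC by auto
    ultimately obtain S where "?C \<subseteq> S" "S \<subseteq> K - ?B" "card S = s"
      using exists_subset_between[of ?C s "K - ?B"] C K by auto
    then show False
      using no unfolding k_def by blast
  qed
  \<comment> \<open>Descending induction from \<open>s = k\<close>. The bound
    \<open>k \<le> 2 * s\<close> keeps \<open>k - s\<close> apart from the values above
    \<open>s + 1\<close> treated earlier and excludes the case \<open>Suc s = k - s\<close>.\<close>
  have big: "k - s < N (Suc s)" if "s \<le> k" "k \<le> 2 * s" for s
    using that
  proof (induction "k - s" arbitrary: s rule: less_induct)
    case less
    have IH: "1 \<le> N x" if "x \<in> {s+2..k+1}" for x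
    proof -
      have "k - (x - 1) < k - s" "x - 1 \<le> k" "k \<le> 2 * (x - 1)" "Suc (x - 1) = x"
        using that less.prems by auto
      then show ?thesis
        using less.hyps[of "x - 1"] by simp
    qed
    \<comment> \<open>Otherwise \<open>s + 1\<close> indices of value \<open>k - s\<close>, together
      with one for each of the \<open>k - s\<close> values in \<open>{s+2..k+1}\<close>, would
      exceed \<open>k\<close>.\<close>
    have "\<not> s < N (k - s)"
    proof
      assume *: "s < N (k - s)"
      define T where "T = {s+2..k+1}"
      have T: "finite T" "card T = k - s" "k - s \<notin> T"
        using less.prems by (auto simp: T_def)
      have "k - s \<le> (\<Sum>x\<in>T. N x)"
        using sum_mono[of T "\<lambda>_. 1" N] IH T by (simp add: T_def)
      moreover have "N (k - s) + (\<Sum>x\<in>T. N x) \<le> k"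
        using T N_sum[of "insert (k - s) T"] by simp
      ultimately show False
        using * less.prems by linarith
    qed
    then show ?case
      using bad[of s] less.prems by auto
  qed
  define h where "h = k div 2"
  define X where "X = (\<lambda>i. k + 1 - i) ` {..h}"
  have "inj_on (\<lambda>i. k + 1 - i) {..h}"
    by (rule inj_onI) (auto simp: h_def)
  then have "(\<Sum>x\<in>X. N x) = (\<Sum>i\<le>h. N (k + 1 - i))"
    unfolding X_def by (subst sum.reindex) auto
  also have "\<dots> \<ge> (\<Sum>i\<le>h. Suc i)"
  proof (rule sum_mono)
    fix i assume "i \<in> {..h}"
    then have "i \<le> k" "k \<le> 2 * (k - i)" "Suc (k - i) = k + 1 - i"
      by (auto simp: h_def)
    then show "Suc i \<le> N (k + 1 - i)"
      using big[of "k - i"] by auto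
  qed
  finally have X: "Suc (2 * h) \<le> (\<Sum>x\<in>X. N x)"
    using double_le_sum_Suc[of h] by linarith
  show False
  \<comment> \<open>The total \<open>2 * h + 1\<close> already exceeds an even \<open>k\<close>. For
    odd \<open>k\<close> one more index is needed: it comes from \<open>s = h\<close>, where both
    forbidden values are \<open>h + 1\<close>, just below the least element \<open>h + 2\<close> of
    \<open>X\<close>.\<close>
  proof (cases "even k")
    case True
    then show False
      using X N_sum[of X] by (auto simp: h_def X_def)
  next
    case False
    then have k: "k = Suc (2 * h)"
      by (simp add: h_def)
    have "0 < N (Suc h)"
      using bad[of h] k by auto
    moreover have "Suc h \<notin> X"
      using k by (auto simp: X_def)
    ultimately have "Suc (Suc (2 * h)) \<le> (\<Sum>x\<in>insert (Suc h) X. N x)"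
      using X by (subst sum.insert) (auto simp: X_def)
    then show False
      using N_sum[of "insert (Suc h) X"] k by (auto simp: X_def)
  qed
qed

section \<open>Trees as parent maps with a depth\<close>

text \<open>Each edge is carried by its lower end. The depth \<open>d\<close> excludes cycles of
  parents and serves as induction measure; only its increments matter, so \<open>d r\<close> is not
  fixed to 0.\<close>

definition rooted_at :: "'a \<Rightarrow> ('a \<Rightarrow> 'a) \<Rightarrow> ('a \<Rightarrow> nat) \<Rightarrow> 'a set \<Rightarrow> 'a set set \<Rightarrow> bool" where
  "rooted_at r p d W F \<longleftrightarrow>
     r \<in> W \<and> (\<forall>w\<in>W - {r}. p w \<in> W \<and> d w = Suc (d (p w))) \<and> F = (\<lambda>w. {w, p w}) ` (W - {r})"

text \<open>Paths instead of walks, because a path closed up by one further vertex must have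
  distinct vertices to be a cycle.\<close>

definition path_connected :: "'a set \<Rightarrow> 'a set set \<Rightarrow> bool" where
  "path_connected W F \<longleftrightarrow>
     (\<forall>x\<in>W. \<forall>y\<in>W. \<exists>q. graph_walk W F q \<and> distinct q \<and> hd q = x \<and> last q = y)"

lemma graph_walk_leaves:
  assumes "graph_walk V E q" "hd q \<in> W" "last q \<notin> W"
  shows "\<exists>x\<in>W. \<exists>y\<in>V - W. {x, y} \<in> E"
  using assms
proof (induction q)
  case Nil
  then show ?case by (simp add: graph_walk_def)
next
  case (Cons z q)
  show ?case
  proof (cases "q = []")
    case True
    then show ?thesis using Cons.prems by auto
  next
    case False
    then have q: "graph_walk V E q" "{z, hd q} \<in> E" "hd q \<in> V" "z \<in> W"
      using Cons.prems by (auto simp: graph_walk_def successively_Cons)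
    show ?thesis
    proof (cases "hd q \<in> W")
      case True
      then show ?thesis using Cons q False by auto
    next
      case False
      then show ?thesis using q by blast
    qed
  qed
qed

lemma graph_walk_mono:
  "graph_walk W F q \<Longrightarrow> W \<subseteq> V \<Longrightarrow> F \<subseteq> E \<Longrightarrow> graph_walk V E q"
  unfolding graph_walk_def by (auto intro: successively_mono)

text \<open>A path in \<open>W\<close> ending or starting at \<open>x\<close> is extended by the
  pendant vertex \<open>y\<close>; it stays distinct because it lies inside
  \<open>W\<close>.\<close>

lemma path_connected_insert:
  assumes "path_connected W F" "x \<in> W" "y \<notin> W"
  shows "path_connected (insert y W) (insert {y, x} F)"
  unfolding path_connected_def
proof (intro ballI)
  let ?ok = "\<lambda>u v q. graph_walk (insert y W) (insert {y, x} F) q \<and> distinct q \<and> hd q = u \<and> last q = v"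
  have old: "\<exists>q. ?ok u v q \<and> set q \<subseteq> W \<and> q \<noteq> []" if "u \<in> W" "v \<in> W" for u v
  proof -
    obtain q where q: "graph_walk W F q" "distinct q" "hd q = u" "last q = v"
      using assms(1) \<open>u \<in> W\<close> \<open>v \<in> W\<close> unfolding path_connected_def by blast
    then have "graph_walk (insert y W) (insert {y, x} F) q"
      by (auto intro: graph_walk_mono)
    then show ?thesis
      using q by (auto simp: graph_walk_def)
  qed
  fix u v assume uv: "u \<in> insert y W" "v \<in> insert y W"
  consider "u \<in> W" "v \<in> W" | "u = y" "v = y" | "u = y" "v \<in> W" | "u \<in> W" "v = y"
    using uv by blast
  then show "\<exists>q. ?ok u v q"
  proof cases
    case 1
    then show ?thesis using old by blast
  next
    case 2
    then have "?ok u v [y]" by (simp add: graph_walk_def)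
    then show ?thesis by blast
  next
    case 3
    then obtain q where "?ok x v q" "set q \<subseteq> W" "q \<noteq> []"
      using old[of x v] assms by blast
    then have "?ok u v (y # q)"
      using 3 assms by (auto simp: graph_walk_def successively_Cons)
    then show ?thesis by blast
  next
    case 4
    then obtain q where "?ok u x q" "set q \<subseteq> W" "q \<noteq> []"
      using old[of u x] assms by blast
    then have "?ok u v (q @ [y])"
      using 4 assms by (auto simp: graph_walk_def successively_append_iff insert_commute)
    then show ?thesis by blast
  qed
qed

text \<open>A maximal vertex set around \<open>r\<close> that induces a rooted, path-connected
  subgraph is all of \<open>V\<close>: an edge leaving it would attach a new leaf, since a second
  edge to the same new vertex would close a cycle.\<close>

lemma tree_rooted_at:
  assumes tree: "is_tree V E" and r: "r \<in> V"
  shows "\<exists>p d. rooted_at r p d V E"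
proof -
  have fin: "finite V" and E: "E \<subseteq> {{u, v} | u v. u \<in> V \<and> v \<in> V \<and> u \<noteq> v}"
    and conn: "graph_connected V E" and acyc: "\<And>q. \<not> graph_cycle V E q"
    using tree by (auto simp: is_tree_def simple_graph_def)
  define good where "good W \<longleftrightarrow> W \<subseteq> V \<and>
    (\<exists>p d. rooted_at r p d W {e \<in> E. e \<subseteq> W}) \<and> path_connected W {e \<in> E. e \<subseteq> W}" for W
  have sing: "{e \<in> E. e \<subseteq> {r}} = {}"
    using E by (auto simp: subset_singleton_iff)
  have "graph_walk {r} {} [r]"
    by (simp add: graph_walk_def)
  then have "path_connected {r} {}"
    unfolding path_connected_def by (auto intro!: exI[of _ "[r]"])
  then have "good {r}"
    using r unfolding good_def sing by (auto simp: rooted_at_def)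
  moreover have "finite {W. good W}"
    by (rule finite_subset[of _ "Pow V"]) (auto simp: good_def fin)
  ultimately obtain W where W: "good W" and max: "\<And>W'. good W' \<Longrightarrow> W \<subseteq> W' \<Longrightarrow> W = W'"
    using finite_has_maximal2[of "{W. good W}" "{r}"] by auto
  obtain p d where pd: "rooted_at r p d W {e \<in> E. e \<subseteq> W}"
    and pc: "path_connected W {e \<in> E. e \<subseteq> W}" and WV: "W \<subseteq> V"
    using W unfolding good_def by blast
  have "W = V"
  proof (rule ccontr)
    assume "W \<noteq> V"
    then obtain z where z: "z \<in> V" "z \<notin> W"
      using WV by blast
    have rW: "r \<in> W"
      using pd by (simp add: rooted_at_def)
    obtain q where "graph_walk V E q" "hd q = r" "last q = z"
      using conn r z unfolding graph_connected_def by blast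
    then obtain x y where x: "x \<in> W" and y: "y \<in> V" "y \<notin> W" and xy: "{x, y} \<in> E"
      using graph_walk_leaves[of V E q W] rW z by auto
    have only: "x' = x" if x': "x' \<in> W" "{x', y} \<in> E" for x'
    proof (rule ccontr)
      assume "x' \<noteq> x"
      obtain q where q: "graph_walk W {e \<in> E. e \<subseteq> W} q" "distinct q" "hd q = x" "last q = x'"
        using pc x x' unfolding path_connected_def by blast
      have "graph_walk V E q"
        using q(1) WV by (rule graph_walk_mono) auto
      moreover have "q \<noteq> []" "set q \<subseteq> W"
        using q by (auto simp: graph_walk_def)
      \<comment> \<open>The ends \<open>x\<close> and \<open>x'\<close> differ, so adding
        \<open>y\<close> gives the three vertices that a cycle requires.\<close>
      moreover have "2 \<le> length q"
        using q \<open>q \<noteq> []\<close> \<open>x' \<noteq> x\<close> by (cases q; cases "tl q") auto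
      ultimately have "graph_cycle V E (q @ [y])"
        using q x' xy y
        by (auto simp: graph_cycle_def graph_walk_def successively_append_iff insert_commute)
      then show False
        using acyc by blast
    qed
    have edges: "{e \<in> E. e \<subseteq> insert y W} = insert {y, x} {e \<in> E. e \<subseteq> W}"
    proof (intro equalityI subsetI)
      fix e assume e: "e \<in> {e \<in> E. e \<subseteq> insert y W}"
      show "e \<in> insert {y, x} {e \<in> E. e \<subseteq> W}"
      proof (cases "y \<in> e")
        case True
        then obtain x' where "e = {x', y}" "x' \<noteq> y"
          using e E by fastforce
        then show ?thesis
          using only[of x'] e by auto
      qed (use e in auto)
    qed (use x xy in \<open>auto simp: insert_commute\<close>)
    have "rooted_at r (p(y := x)) (d(y := Suc (d x))) (insert y W) {e \<in> E. e \<subseteq> insert y W}"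
    proof -
      have "insert y W - {r} = insert y (W - {r})"
        using y rW by auto
      moreover have "(\<lambda>w. {w, (p(y := x)) w}) ` (W - {r}) = (\<lambda>w. {w, p w}) ` (W - {r})"
        using y by (intro image_cong) auto
      ultimately show ?thesis
        using pd x y unfolding edges rooted_at_def by auto
    qed
    moreover have "path_connected (insert y W) {e \<in> E. e \<subseteq> insert y W}"
      unfolding edges using path_connected_insert[OF pc x y(2)] .
    ultimately have "good (insert y W)"
      using WV y unfolding good_def by auto
    then show False
      using max[of "insert y W"] y by auto
  qed
  moreover have "{e \<in> E. e \<subseteq> V} = E"
    using E by auto
  ultimately show ?thesis
    using pd by auto
qed

section \<open>Children and the choice of the root\<close>

text \<open>The root is removed because \<open>p r\<close> is an arbitrary value.\<close>

definition children :: "'a \<Rightarrow> ('a \<Rightarrow> 'a) \<Rightarrow> 'a set \<Rightarrow> 'a \<Rightarrow> 'a set" where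
  "children r p V w = {u \<in> V - {r}. p u = w}"

lemma rooted_at_edge_iff:
  assumes "rooted_at r p d V E"
  shows "{u, w} \<in> E \<longleftrightarrow> u \<in> children r p V w \<or> w \<in> children r p V u"
  using assms by (auto simp: rooted_at_def children_def doubleton_eq_iff)

lemma rooted_at_parent_neq:
  "rooted_at r p d V E \<Longrightarrow> w \<in> V - {r} \<Longrightarrow> p w \<noteq> w"
  unfolding rooted_at_def by (metis n_not_Suc_n)

text \<open>Two vertices carrying the same edge would be parents of each other, against the depths.
  Hence edges can be counted by their lower ends.\<close>

lemma rooted_at_inj:
  assumes "rooted_at r p d V E"
  shows "inj_on (\<lambda>w. {w, p w}) (V - {r})"
proof (rule inj_onI)
  fix u w assume *: "u \<in> V - {r}" "w \<in> V - {r}" "{u, p u} = {w, p w}"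
  then have "d u = Suc (d (p u))" "d w = Suc (d (p w))"
    using assms unfolding rooted_at_def by blast+
  then show "u = w"
    using *(3) by (auto simp: doubleton_eq_iff)
qed

text \<open>A parent of a deepest vertex has at most one non-leaf neighbour.\<close>

lemma tree_has_penultimate_vertex:
  assumes tree: "is_tree V E" and card: "3 \<le> card V"
  shows "\<exists>v\<in>V. 2 \<le> card {u. {u, v} \<in> E} \<and>
    (\<exists>y. \<forall>u. {u, v} \<in> E \<longrightarrow> u \<noteq> y \<longrightarrow> (\<forall>w. {w, u} \<in> E \<longrightarrow> w = v))"
proof -
  have fin: "finite V"
    using tree by (simp add: is_tree_def simple_graph_def)
  obtain r where r: "r \<in> V"
    using card by fastforce
  obtain p d where pd: "rooted_at r p d V E"
    using tree_rooted_at[OF tree r] by blast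
  note edge = rooted_at_edge_iff[OF pd]
  have par: "p w \<in> V" "d w = Suc (d (p w))" if "w \<in> V - {r}" for w
    using pd that by (auto simp: rooted_at_def)
  define D where "D = Max (d ` V)"
  have D: "d u \<le> D" if "u \<in> V" for u
    using fin that by (simp add: D_def)
  have "D \<in> d ` V"
    unfolding D_def using fin r by (intro Max_in) auto
  then obtain w where w: "w \<in> V" "d w = D"
    by auto
  have "V - {r} \<noteq> {}"
    using card r fin card_Diff_singleton[of r V] by (intro notI) auto
  then obtain z where z: "z \<in> V - {r}"
    by blast
  \<comment> \<open>Passing to the parent lowers the depth, and this descent can only stop at
    \<open>r\<close>.\<close>
  have ge: "d r \<le> d u" if "u \<in> V" for u
    using that
  proof (induction "d u" arbitrary: u rule: less_induct)
    case less
    show ?case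
    proof (cases "u = r")
      case False
      then have "p u \<in> V" "d u = Suc (d (p u))"
        using par[of u] less.prems by auto
      then show ?thesis
        using less.hyps[of "p u"] by simp
    qed simp
  qed
  have "w \<noteq> r"
  proof
    assume "w = r"
    then have "d z \<le> d r" "d r \<le> d (p z)"
      using D[of z] w z ge[of "p z"] par[of z] by auto
    then show False
      using par[of z] z by auto
  qed
  then have w': "w \<in> V - {r}"
    using w by simp
  define v where "v = p w"
  have v: "v \<in> V" "Suc (d v) = D" "w \<in> children r p V v"
    using par[OF w'] w w' by (auto simp: v_def children_def)
  have childless: "children r p V u = {}" if "u \<in> children r p V v" for u
  proof (rule ccontr)
    assume "children r p V u \<noteq> {}"
    then obtain t where "t \<in> V - {r}" "p t = u"
      by (auto simp: children_def)
    then have "d t = Suc (Suc (d v))"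
      using that par[of t] par[of u] by (auto simp: children_def)
    then show False
      using D[of t] \<open>t \<in> V - {r}\<close> v by auto
  qed
  have leaf: "t = v" if "u \<in> children r p V v" "{t, u} \<in> E" for t u
    using that childless[of u] edge[of t u] by (auto simp: children_def)
  have nb: "{u. {u, v} \<in> E} \<subseteq> V"
    unfolding edge using par(1) by (auto simp: children_def)
  then have finN: "finite {u. {u, v} \<in> E}"
    using fin finite_subset by blast
  \<comment> \<open>If \<open>v\<close> is the root, the maximal depth is \<open>d r + 1\<close>, so
    all other vertices are children of \<open>v\<close>.\<close>
  have two: "2 \<le> card {u. {u, v} \<in> E}" if "v = r"
  proof -
    have "p u = r" if u: "u \<in> V - {r}" for u
    proof (rule ccontr)
      assume "p u \<noteq> r"
      then have "p u \<in> V - {r}"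
        using par[OF u] by simp
      then show False
        using par[OF u] par[of "p u"] ge[of "p (p u)"] D[of u] u v(2) \<open>v = r\<close> by auto
    qed
    then have "V - {r} \<subseteq> {u. {u, v} \<in> E}"
      unfolding edge using \<open>v = r\<close> by (auto simp: children_def)
    then have "card (V - {r}) \<le> card {u. {u, v} \<in> E}"
      using finN by (rule card_mono[rotated])
    then show ?thesis
      using card r fin by simp
  qed
  have "2 \<le> card {u. {u, v} \<in> E}"
  proof (cases "v = r")
    case False
    then have "v \<in> V - {r}"
      using v by simp
    then have "{w, p v} \<subseteq> {u. {u, v} \<in> E}"
      unfolding edge using v by (auto simp: children_def)
    moreover have "w \<noteq> p v"
      using par[OF \<open>v \<in> V - {r}\<close>] w v by auto
    ultimately show ?thesis
      using card_mono[OF finN, of "{w, p v}"] by auto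
  qed (rule two)
  \<comment> \<open>The exceptional neighbour is the parent of \<open>v\<close>. For
    \<open>v = r\<close> the value \<open>p v\<close> is arbitrary, but then all neighbours are
    children and hence leaves.\<close>
  moreover have "\<forall>u. {u, v} \<in> E \<longrightarrow> u \<noteq> p v \<longrightarrow> (\<forall>t. {t, u} \<in> E \<longrightarrow> t = v)"
    using leaf edge by (auto simp: children_def)
  ultimately show ?thesis
    using v(1) by blast
qed


section \<open>Choice of the repeating child edges and of the colours\<close>

text \<open>Recursion from the leaves up, with \<open>balanced_split\<close> at each vertex. For
  non-root \<open>w\<close>, \<open>Suc (card (S w))\<close> will be its degree in the colour of its
  parent edge, and the difference its degree in the other colour.\<close>

lemma rooted_at_balanced_choice:
  assumes pd: "rooted_at r p d V E" and fin: "finite V"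
  shows "\<exists>S. \<forall>w. S w \<subseteq> children r p V w \<and>
    (\<forall>u\<in>S w. Suc (card (S u)) \<noteq> Suc (card (S w))) \<and>
    (\<forall>u\<in>children r p V w - S w. Suc (card (S u)) \<noteq> card (children r p V w) - card (S w))"
proof (rule dependent_wf_choice[where R = "{(u, w). u \<in> children r p V w}"])
  define D where "D = Max (d ` V)"
  \<comment> \<open>The measure counts down from the maximal depth, so that children are treated
    before their parent.\<close>
  have "D - d u < D - d w" if "u \<in> children r p V w" for u w
  proof -
    have u: "u \<in> V" "d u = Suc (d w)"
      using that pd by (auto simp: children_def rooted_at_def)
    have "d u \<le> D"
      unfolding D_def using fin u(1) by (intro Max_ge) auto
    then show ?thesis
      using u(2) by simp
  qed
  then show "wf {(u, w). u \<in> children r p V w}"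
    by (intro wf_subset[OF wf_measure[of "\<lambda>x. D - d x"]]) auto
next
  fix w and S :: "'a \<Rightarrow> 'a set"
  have "finite (children r p V w)"
    using fin by (simp add: children_def)
  from balanced_split[OF this, of "\<lambda>u. Suc (card (S u))"]
  show "\<exists>T. T \<subseteq> children r p V w \<and>
    (\<forall>u\<in>T. Suc (card (S u)) \<noteq> Suc (card T)) \<and>
    (\<forall>u\<in>children r p V w - T. Suc (card (S u)) \<noteq> card (children r p V w) - card T)"
    by blast
next
  fix S S' :: "'a \<Rightarrow> 'a set" and w T
  assume "\<And>u. (u, w) \<in> {(u, w). u \<in> children r p V w} \<Longrightarrow> S u = S' u"
  then have eq: "S u = S' u" if "u \<in> children r p V w" for u
    using that by blast
  show "(T \<subseteq> children r p V w \<and>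
    (\<forall>u\<in>T. Suc (card (S u)) \<noteq> Suc (card T)) \<and>
    (\<forall>u\<in>children r p V w - T. Suc (card (S u)) \<noteq> card (children r p V w) - card T)) =
   (T \<subseteq> children r p V w \<and>
    (\<forall>u\<in>T. Suc (card (S' u)) \<noteq> Suc (card T)) \<and>
    (\<forall>u\<in>children r p V w - T. Suc (card (S' u)) \<noteq> card (children r p V w) - card T))"
    using eq by (intro conj_cong refl ball_cong) auto
qed

text \<open>The colour of the edge joining \<open>w\<close> to its parent is stored at \<open>w\<close>; all edges at the root
  are \<open>True\<close>, and \<open>S w\<close> collects the children whose edge repeats the colour of \<open>w\<close>.\<close>

lemma rooted_at_colour_choice:
  assumes pd: "rooted_at r p d V E"
  shows "\<exists>c. \<forall>w\<in>V - {r}. c w \<longleftrightarrow> p w = r \<or> (w \<in> S (p w) \<longleftrightarrow> c (p w))"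
proof -
  \<comment> \<open>The test \<open>p w = r\<close> comes first, so the colour stored at
    \<open>r\<close> is an arbitrary default.\<close>
  let ?P = "\<lambda>c w x. w \<in> V - {r} \<longrightarrow> (x \<longleftrightarrow> p w = r \<or> (w \<in> S (p w) \<longleftrightarrow> c (p w)))"
  let ?R = "{(u, w). w \<in> V - {r} \<and> u = p w}"
  have "\<exists>c. \<forall>w. ?P c w (c w)"
  proof (rule dependent_wf_choice[where R = ?R and P = ?P])
    show "wf ?R"
      using pd by (intro wf_subset[OF wf_measure[of d]]) (auto simp: rooted_at_def)
  next
    fix c c' :: "'a \<Rightarrow> bool" and w x
    assume "\<And>z. (z, w) \<in> ?R \<Longrightarrow> c z = c' z"
    then have "w \<in> V - {r} \<Longrightarrow> c (p w) = c' (p w)"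
      by blast
    then show "?P c w x = ?P c' w x"
      by auto
  next
    fix c :: "'a \<Rightarrow> bool" and w
    show "\<exists>x. ?P c w x"
      by blast
  qed
  then show ?thesis
    by blast
qed

section \<open>From colour degrees to a bound on the doubling parameter\<close>

text \<open>Edges are named by their lower ends: \<open>W = V - {r}\<close> yields the degree in the
  simple tree, the set of doubled edges yields the contribution of the extra copies.\<close>

definition colour_degree :: "('a \<Rightarrow> 'a) \<Rightarrow> ('a \<Rightarrow> bool) \<Rightarrow> 'a set \<Rightarrow> 'a \<Rightarrow> bool \<Rightarrow> nat" where
  "colour_degree p c W x b = card {u \<in> W. c u = b \<and> x \<in> {u, p u}}"

text \<open>Doubling the edges above the vertices of \<open>W\<close> makes each degree in a colour
  the sum of two colour degrees, and every edge joins some \<open>w\<close> to \<open>p w\<close> in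
  the colour \<open>c w\<close>.\<close>

lemma D_lir_le_card:
  assumes pd: "rooted_at r p d V E" and fin: "finite V" and W: "W \<subseteq> V - {r}"
    and irr: "\<And>w. w \<in> V - {r} \<Longrightarrow>
      colour_degree p c (V - {r}) w (c w) + colour_degree p c W w (c w) \<noteq>
      colour_degree p c (V - {r}) (p w) (c w) + colour_degree p c W (p w) (c w)"
  shows "D_lir V E \<le> enat (card W)"
proof -
  define f where "f w = {w, p w}" for w
  have inj: "inj_on f (V - {r})"
    unfolding f_def using rooted_at_inj[OF pd] .
  have E: "E = f ` (V - {r})"
    using pd by (simp add: rooted_at_def f_def)
  \<comment> \<open>The colour is read off the endvertices alone, so parallel copies agree.\<close>
  define col :: "'a set \<times> bool \<Rightarrow> nat" where
    "col e = of_bool (c (inv_into (V - {r}) f (fst e)))" for e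
  have col: "col (f w, b) = of_bool (c w)" if "w \<in> V - {r}" for w b
    using inv_into_f_f[OF inj that] by (simp add: col_def)
  let ?M = "double_edges V E (f ` W)"
  have medges: "medges ?M = (\<lambda>w. (f w, False)) ` (V - {r}) \<union> (\<lambda>w. (f w, True)) ` W"
    by (auto simp: double_edges_def E)
  have ends: "ends ?M e = fst e" for e
    by (simp add: double_edges_def)
  let ?N = "\<lambda>b. edge_induced ?M {e \<in> medges ?M. col e = of_bool b}"
  have deg: "mdegree (?N b) x = colour_degree p c (V - {r}) x b + colour_degree p c W x b" for x b
  proof -
    let ?A = "\<lambda>U. {u \<in> U. c u = b \<and> x \<in> {u, p u}}"
    have "{e \<in> {e \<in> medges ?M. col e = of_bool b}. x \<in> fst e} =
        (\<lambda>w. (f w, False)) ` ?A (V - {r}) \<union> (\<lambda>w. (f w, True)) ` ?A W"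
    proof -
      have "(col (f u, t) = of_bool b \<and> x \<in> fst (f u, t)) = (c u = b \<and> x \<in> {u, p u})"
        if "u \<in> V - {r}" for u t
        unfolding col[OF that] by (simp add: f_def)
      then have "{u \<in> U. col (f u, t) = of_bool b \<and> x \<in> fst (f u, t)} = ?A U"
        if "U \<subseteq> V - {r}" for U t
        using that by blast
      note this[OF order_refl] this[OF W]
      moreover have "{e \<in> {e \<in> g ` A \<union> h ` B. P e}. Q e} =
          g ` {a \<in> A. P (g a) \<and> Q (g a)} \<union> h ` {a \<in> B. P (h a) \<and> Q (h a)}"
        for g h :: "'a \<Rightarrow> 'a set \<times> bool" and A B P Q
        by blast
      ultimately show ?thesis
        unfolding medges by simp
    qed
    moreover have "card ((\<lambda>w. (f w, False)) ` ?A (V - {r})) = card (?A (V - {r}))"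
      using inj by (intro card_image) (auto simp: inj_on_def)
    moreover have "card ((\<lambda>w. (f w, True)) ` ?A W) = card (?A W)"
      using inj W by (intro card_image) (auto simp: inj_on_def)
    moreover have "finite (?A (V - {r}))" "finite (?A W)"
      using fin finite_subset[OF W] by auto
    moreover have "((\<lambda>w. (f w, False)) ` ?A (V - {r})) \<inter> ((\<lambda>w. (f w, True)) ` ?A W) = {}"
      by blast
    ultimately have "card {e \<in> {e \<in> medges ?M. col e = of_bool b}. x \<in> fst e} =
        card (?A (V - {r})) + card (?A W)"
      by (simp add: card_Un_disjoint)
    then show ?thesis
      by (simp add: mdegree_def edge_induced_def ends colour_degree_def)
  qed
  have loc: "locally_irregular (?N b)" for b
    unfolding locally_irregular_def
  proof (intro ballI impI)
    fix e x y assume "e \<in> medges (?N b)" and xy: "x \<in> ends (?N b) e" "y \<in> ends (?N b) e" "x \<noteq> y"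
    then have "e \<in> medges ?M" and b: "col e = of_bool b"
      by (auto simp: edge_induced_def)
    then obtain w t where w: "w \<in> V - {r}" and e: "e = (f w, t)"
      unfolding medges using W by blast
    then have "c w = b"
      using b col[OF w, of t] by (cases "c w"; cases b) simp_all
    moreover have "x = w \<and> y = p w \<or> x = p w \<and> y = w"
      using xy e by (auto simp: edge_induced_def double_edges_def f_def)
    ultimately show "mdegree (?N b) x \<noteq> mdegree (?N b) y"
      unfolding deg using irr[OF w] by auto
  qed
  have "locally_irregular (edge_induced ?M {e \<in> medges ?M. col e = i})" if "i < 2" for i
  proof -
    have i: "i = of_bool (i = 1)"
      using that by auto
    show ?thesis
      by (subst i) (rule loc)
  qed
  then have "lir_2_colouring ?M col"
    unfolding lir_2_colouring_def by (auto simp: ends col_def)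
  moreover have "f ` W \<subseteq> E"
    using W E by blast
  ultimately have "D_lir V E \<le> enat (card (f ` W))"
    unfolding D_lir_def by (intro INF_lower) blast
  also have "card (f ` W) = card W"
    using inj W by (meson card_image inj_on_subset)
  finally show ?thesis .
qed

section \<open>The colouring of a tree and its repair at the root\<close>

theorem mainTheorem3:
  fixes V :: "'a set" and E :: "'a set set"
  assumes "is_tree V E" and "card V \<ge> 3"
  shows "D_lir V E \<le> 1"
proof -
  have fin: "finite V"
    using assms(1) by (simp add: is_tree_def simple_graph_def)
  obtain r y where r: "r \<in> V" and two: "2 \<le> card {u. {u, r} \<in> E}"
    and leaf: "\<And>u w. {u, r} \<in> E \<Longrightarrow> u \<noteq> y \<Longrightarrow> {w, u} \<in> E \<Longrightarrow> w = r"
    using tree_has_penultimate_vertex[OF assms] by blast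
  obtain p d where pd: "rooted_at r p d V E"
    using tree_rooted_at[OF assms(1) r] by blast
  define ch where "ch = children r p V"
  note edge = rooted_at_edge_iff[OF pd, folded ch_def]
  have par: "p w \<in> V" "p w \<noteq> w" if "w \<in> V - {r}" for w
    using pd rooted_at_parent_neq[OF pd that] that by (auto simp: rooted_at_def)
  have fin_ch: "finite (ch w)" for w
    using fin by (simp add: ch_def children_def)
  have "{u. {u, r} \<in> E} = ch r"
    unfolding edge by (auto simp: ch_def children_def)
  with two have two: "2 \<le> card (ch r)"
    by simp
  have childless: "ch u = {}" if "u \<in> ch r" "u \<noteq> y" for u
  proof (rule ccontr)
    assume "ch u \<noteq> {}"
    then obtain t where "t \<in> ch u"
      by blast
    then show False
      using leaf[of u t] that edge by (auto simp: ch_def children_def)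
  qed
  obtain S where S: "\<And>w. S w \<subseteq> ch w"
      "\<And>w u. u \<in> S w \<Longrightarrow> Suc (card (S u)) \<noteq> Suc (card (S w))"
      "\<And>w u. u \<in> ch w - S w \<Longrightarrow> Suc (card (S u)) \<noteq> card (ch w) - card (S w)"
    using rooted_at_balanced_choice[OF pd fin] unfolding ch_def by blast
  obtain c where "\<forall>w\<in>V - {r}. c w \<longleftrightarrow> p w = r \<or> (w \<in> S (p w) \<longleftrightarrow> c (p w))"
    using rooted_at_colour_choice[OF pd, of S] by blast
  then have c: "c w \<longleftrightarrow> p w = r \<or> (w \<in> S (p w) \<longleftrightarrow> c (p w))" if "w \<in> V - {r}" for w
    using that by (rule bspec)
  let ?deg = "colour_degree p c (V - {r})"
  \<comment> \<open>A child edge of \<open>w\<close> has colour \<open>c w\<close> exactly when the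
    child lies in \<open>S w\<close>; the edge above \<open>w\<close> accounts for the
    successor.\<close>
  have deg_up: "?deg w (c w) = Suc (card (S w))" if "w \<in> V - {r}" for w
  proof -
    have "{u \<in> V - {r}. c u = c w \<and> w \<in> {u, p u}} = insert w (S w)"
      using that S(1)[of w] c by (auto simp: ch_def children_def)
    moreover have "w \<notin> S w"
      using that S(1)[of w] par by (auto simp: ch_def children_def)
    ultimately show ?thesis
      using finite_subset[OF S(1) fin_ch, of w] by (simp add: colour_degree_def)
  qed
  have deg_other: "?deg w (\<not> c w) = card (ch w) - card (S w)" if "w \<in> V - {r}" for w
  proof -
    have "{u \<in> V - {r}. c u = (\<not> c w) \<and> w \<in> {u, p u}} = ch w - S w"
      using that S(1)[of w] c by (auto simp: ch_def children_def)
    then show ?thesis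
      using finite_subset[OF S(1) fin_ch, of w] S(1) by (simp add: colour_degree_def card_Diff_subset)
  qed
  have deg_root: "?deg r True = card (ch r)"
  proof -
    have "{u \<in> V - {r}. c u = True \<and> r \<in> {u, p u}} = ch r"
      using c by (auto simp: ch_def children_def)
    then show ?thesis
      by (simp add: colour_degree_def)
  qed
  \<comment> \<open>The degree of \<open>p w\<close> in this colour is one of the two values avoided
    by the choice of \<open>S\<close>, depending on whether \<open>w\<close> lies in
    \<open>S (p w)\<close>.\<close>
  have inner: "?deg w (c w) \<noteq> ?deg (p w) (c w)" if w: "w \<in> V - {r}" "p w \<noteq> r" for w
  proof -
    have pw: "p w \<in> V - {r}" "w \<in> ch (p w)"
      using w par by (auto simp: ch_def children_def)
    show ?thesis
    proof (cases "w \<in> S (p w)")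
      case True
      then have eq: "c (p w) = c w"
        using c w by auto
      show ?thesis
        using S(2)[OF True] deg_up[OF w(1)] deg_up[OF pw(1)] unfolding eq by simp
    next
      case False
      then have eq: "(\<not> c (p w)) = c w"
        using c w by auto
      show ?thesis
        using S(3)[of w "p w"] False pw deg_up[OF w(1)] deg_other[OF pw(1)] unfolding eq by simp
    qed
  qed
  have top: "w \<in> ch r" "c w" if "w \<in> V - {r}" "p w = r" for w
    using that c by (auto simp: ch_def children_def)
  have empty: "colour_degree p c {} x b = 0" for x b
    by (simp add: colour_degree_def)
  show ?thesis
  proof (cases "\<exists>u\<in>ch r. Suc (card (S u)) = card (ch r)")
    case False
    have "?deg w (c w) \<noteq> ?deg (p w) (c w)" if w: "w \<in> V - {r}" for w
    proof (cases "p w = r")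
      case True
      then show ?thesis
        using False top[OF w True] deg_up[OF w] deg_root by simp
    qed (use inner w in blast)
    then have "D_lir V E \<le> enat (card ({} :: 'a set))"
      by (intro D_lir_le_card[OF pd fin, where c = c]) (simp_all add: empty)
    also have "\<dots> \<le> 1"
      by (simp add: zero_enat_def[symmetric])
    finally show ?thesis .
  next
    case True
    then obtain u where u: "u \<in> ch r" "Suc (card (S u)) = card (ch r)"
      by blast
    have Sleaf: "S t = {}" if "t \<in> ch r" "t \<noteq> y" for t
      using childless[OF that] S(1) by blast
    \<comment> \<open>A leaf has degree 1 in its colour, while the root has degree at least
      2.\<close>
    have "u = y"
      using u two Sleaf[of u] by (cases "u = y") auto
    have "\<not> ch r \<subseteq> {y}"
      using two card_mono[of "{y}" "ch r"] by auto
    then obtain l where l: "l \<in> ch r" "l \<noteq> y"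
      by blast
    have lV: "l \<in> V - {r}" "p l = r"
      using l by (auto simp: ch_def children_def)
    have extra: "colour_degree p c {l} x b = of_bool (b \<and> x \<in> {l, r})" for x b
    proof -
      have "{u \<in> {l}. c u = b \<and> x \<in> {u, p u}} = (if b \<and> x \<in> {l, r} then {l} else {})"
        using top[OF lV] lV by auto
      then show ?thesis
        by (simp add: colour_degree_def)
    qed
    \<comment> \<open>With \<open>k = card (ch r)\<close>, the root now has degree
      \<open>k + 1\<close>, while \<open>y\<close> keeps \<open>k\<close>, \<open>l\<close> gets 2
      and other leaves have 1; \<open>2 < k + 1\<close> holds by \<open>two\<close>.\<close>
    have "?deg w (c w) + colour_degree p c {l} w (c w) \<noteq>
        ?deg (p w) (c w) + colour_degree p c {l} (p w) (c w)" if w: "w \<in> V - {r}" for w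
    proof (cases "p w = r")
      case True
      then have "card (S w) = 0 \<or> w = y \<and> w \<noteq> l"
        using Sleaf top[OF w True] l by fastforce
      then show ?thesis
        using top[OF w True] deg_up[OF w] deg_root True two u \<open>u = y\<close> l w by (auto simp: extra)
    next
      case False
      \<comment> \<open>As \<open>l\<close> is a child of the root without children, the edge above
        \<open>w\<close> meets neither \<open>l\<close> nor \<open>r\<close>, and its degrees are
        unchanged.\<close>
      then have "w \<noteq> l" "w \<noteq> r" "p w \<noteq> l"
        using lV w childless[OF l] by (auto simp: ch_def children_def)
      then show ?thesis
        using inner[OF w False] False by (simp add: extra)
    qed
    then have "D_lir V E \<le> enat (card {l})"
      using lV by (intro D_lir_le_card[OF pd fin, where c = c]) simp_all
    then show ?thesis
      by (simp add: one_enat_def)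
  qed
qed

end
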